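(* Let $s\in(0,1)$, let $W$ and $\sigma$ satisfy the assumptions listed in the context, let $N=2$, $\zeta_1=+1$, $\zeta_2=-1$, $x_1^0<x_2^0$, let $\theta_0:=x_2^0-x_1^0$, and let $T_c\in(0,+\infty]$ be the collision time of the particle system described in the context. Then: 1. If $\sigma(t,x)\le0$ for all $t\ge0$ and all $x\in\mathbb R$, then $$T_c\le\frac{s\,\theta_0^{2s+1}}{(2s+1)\gamma}.$$ 2. If $$\theta_0<\left(\frac{1}{2s\|\sigma\|_\infty}\right)^{\frac1{2s}}$$ (a condition regarded as satisfied if $\|\sigma\|_\infty=0$), then $$T_c\le\frac{s\,\theta_0^{1+2s}}{\gamma\,(1-2s\,\theta_0^{2s}\|\sigma\|_\infty)}.$$ 3. Conversely, if the condition in item 2 is violated there are examples in which $T_c=+\infty$; that is, there exist $\sigma$ satisfying the assumptions in the context and initial data $x_1^0<x_2^0$ with $\theta_0\ge\left(\frac{1}{2s\|\sigma\|_\infty}\right)^{\frac1{2s}}$ such that $T_c=+\infty$.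
   Context: Operator: for $s\in(0,1)$ and $\varphi\in C^2(\mathbb R)\cap L^\infty(\mathbb R)$, $\mathcal I_s[\varphi](x):=PV\int_{\mathbb R}\frac{\varphi(x+y)-\varphi(x)}{|y|^{1+2s}}\,dy$. Assumptions on $W$: $W\in C^{3,\alpha}(\mathbb R)$ for some $0<\alpha<1$; $W(v+1)=W(v)$ for all $v\in\mathbb R$; $W=0$ on $\mathbb Z$; $W>0$ on $\mathbb R\setminus\mathbb Z$; $W''(0)>0$. Assumptions on $\sigma$: $\sigma$ is bounded and uniformly continuous on $[0,+\infty)\times\mathbb R$, and for some $M>0$ and some $\alpha\in(s,1)$: $\|\sigma_x\|_{L^\infty([0,+\infty)\times\mathbb R)}+\|\sigma_t\|_{L^\infty([0,+\infty)\times\mathbb R)}\le M$ and $|\sigma_x(t,x+h)-\sigma_x(t,x)|\le M|h|^\alpha$ for all $x,h\in\mathbb R$, $t\ge0$. $\|\sigma\|_\infty$ is the sup norm on $[0,+\infty)\times\mathbb R$. Layer solution: $u$ is the unique solution of $\mathcal I_s(u)=W'(u)$ in $\mathbb R$, $u'>0$ in $\mathbb R$, $\lim_{x\to-\infty}u(x)=0$, $\lim_{x\to+\infty}u(x)=1$, $u(0)=\tfrac12$ (its existence and uniqueness are known). Set $\gamma:=\left(\int_{\mathbb R}(u'(x))^2dx\right)^{-1}>0$. Particle system: $(x_i(t))_{i=1,\dots,N}$ solves $$\dot x_i=\gamma\left(\sum_{j\ne i}\zeta_i\zeta_j\frac{x_i-x_j}{2s|x_i-x_j|^{1+2s}}-\zeta_i\sigma(t,x_i)\right)\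 \text{ in }(0,T_c),\qquad x_i(0)=x_i^0,$$ where $(0,T_c)$, $0<T_c\le+\infty$, is the maximal interval on which the system is well defined, i.e. on which $x_i\ne x_j$ for all $i\ne j$; thus $T_c$ is the first collision time ($+\infty$ if there is no collision). *)

theory Defs
  imports "HOL-Analysis.Analysis"
begin

definition C_class :: "nat \<Rightarrow> (real \<Rightarrow> real) \<Rightarrow> bool" where
  "C_class k f \<longleftrightarrow>
     (\<forall>j<k. \<forall>x. (deriv ^^ j) f differentiable at x) \<and> continuous_on UNIV ((deriv ^^ k) f)"

text \<open>Finite Hoelder norm on the whole line: the derivatives up to order \<open>k\<close> are bounded and the
  \<open>k\<close>-th one is globally Hoelder continuous.  For a periodic function this is the same as the local
  requirement.\<close>

definition holder_class :: "nat \<Rightarrow> real \<Rightarrow> (real \<Rightarrow> real) \<Rightarrow> bool" where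
  "holder_class k \<alpha> f \<longleftrightarrow>
     C_class k f \<and> (\<forall>j\<le>k. bounded (range ((deriv ^^ j) f))) \<and>
     (\<exists>C. \<forall>x y. \<bar>(deriv ^^ k) f x - (deriv ^^ k) f y\<bar> \<le> C * \<bar>x - y\<bar> powr \<alpha>)"

text \<open>\<open>has_frac_op s \<phi> x L\<close> means that the principal value defining \<open>I\<^sub>s[\<phi>](x)\<close> converges and equals
  \<open>L\<close>.  For \<open>0 < s < 1\<close> and \<open>\<phi>\<close> bounded of class \<open>C\<^sup>2\<close> the truncated integrands are integrable and
  the limit exists.\<close>

definition has_frac_op :: "real \<Rightarrow> (real \<Rightarrow> real) \<Rightarrow> real \<Rightarrow> real \<Rightarrow> bool" where
  "has_frac_op s \<phi> x L \<longleftrightarrow>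
     ((\<lambda>\<epsilon>. LINT y:{y. \<epsilon> < \<bar>y\<bar>}|lborel. (\<phi> (x + y) - \<phi> x) / \<bar>y\<bar> powr (1 + 2 * s)) \<longlongrightarrow> L)
       (at_right 0)"

definition multiwell_potential :: "(real \<Rightarrow> real) \<Rightarrow> bool" where
  "multiwell_potential W \<longleftrightarrow>
     (\<exists>\<alpha>. 0 < \<alpha> \<and> \<alpha> < 1 \<and> holder_class 3 \<alpha> W) \<and>
     (\<forall>v. W (v + 1) = W v) \<and>
     (\<forall>v\<in>\<int>. W v = 0) \<and>
     (\<forall>v. v \<notin> \<int> \<longrightarrow> W v > 0) \<and>
     (deriv ^^ 2) W 0 > 0"

definition layer_solution :: "real \<Rightarrow> (real \<Rightarrow> real) \<Rightarrow> (real \<Rightarrow> real) \<Rightarrow> bool" where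
  "layer_solution s W u \<longleftrightarrow>
     C_class 2 u \<and> bounded (range u) \<and>
     (\<forall>x. has_frac_op s u x (deriv W (u x))) \<and>
     (\<forall>x. deriv u x > 0) \<and>
     (u \<longlongrightarrow> 0) at_bot \<and> (u \<longlongrightarrow> 1) at_top \<and> u 0 = 1 / 2"

definition layer_const :: "(real \<Rightarrow> real) \<Rightarrow> real" where
  "layer_const u = inverse (\<integral>x. (deriv u x)\<^sup>2 \<partial>lborel)"

text \<open>Functions of \<open>(t, x)\<close> are only relevant for \<open>t \<ge> 0\<close>.  The value below is the supremum norm
  only for functions that are bounded on that half-plane.\<close>

definition supnorm :: "(real \<Rightarrow> real \<Rightarrow> real) \<Rightarrow> real" where
  "supnorm f = (SUP (t, x)\<in>{0..} \<times> UNIV. \<bar>f t x\<bar>)"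

definition bounded_stress :: "(real \<Rightarrow> real \<Rightarrow> real) \<Rightarrow> bool" where
  "bounded_stress f \<longleftrightarrow> bounded ((\<lambda>(t, x). f t x) ` ({0..} \<times> UNIV))"

text \<open>\<open>\<sigma>x\<close> and \<open>\<sigma>t\<close> are the (classical) partial derivatives; the time derivative is one-sided at
  \<open>t = 0\<close>.\<close>

definition admissible_stress :: "real \<Rightarrow> (real \<Rightarrow> real \<Rightarrow> real) \<Rightarrow> bool" where
  "admissible_stress s \<sigma> \<longleftrightarrow>
     bounded_stress \<sigma> \<and>
     uniformly_continuous_on ({0..} \<times> UNIV) (\<lambda>(t, x). \<sigma> t x) \<and>
     (\<exists>\<sigma>x \<sigma>t M \<alpha>. M > 0 \<and> s < \<alpha> \<and> \<alpha> < 1 \<and>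
        (\<forall>t\<ge>0. \<forall>x. ((\<lambda>z. \<sigma> t z) has_real_derivative \<sigma>x t x) (at x)) \<and>
        (\<forall>t\<ge>0. \<forall>x. ((\<lambda>r. \<sigma> r x) has_real_derivative \<sigma>t t x) (at t within {0..})) \<and>
        bounded_stress \<sigma>x \<and> bounded_stress \<sigma>t \<and> supnorm \<sigma>x + supnorm \<sigma>t \<le> M \<and>
        (\<forall>t\<ge>0. \<forall>x h. \<bar>\<sigma>x t (x + h) - \<sigma>x t x\<bar> \<le> M * \<bar>h\<bar> powr \<alpha>))"

definition particle_velocity ::
  "real \<Rightarrow> real \<Rightarrow> nat \<Rightarrow> (nat \<Rightarrow> real) \<Rightarrow> (real \<Rightarrow> real \<Rightarrow> real) \<Rightarrow> real \<Rightarrow> (nat \<Rightarrow> real) \<Rightarrow> nat \<Rightarrow> real"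
where
  "particle_velocity s \<gamma> N \<zeta> \<sigma> t X i =
     \<gamma> * ((\<Sum>j\<in>{1..N} - {i}. \<zeta> i * \<zeta> j * ((X i - X j) / (2 * s * \<bar>X i - X j\<bar> powr (1 + 2 * s))))
          - \<zeta> i * \<sigma> t (X i))"

text \<open>Particles are numbered \<open>1, \<dots>, N\<close>; \<open>x t i\<close> is the position of particle \<open>i\<close> at time \<open>t\<close>.
  Values of \<open>x\<close> outside \<open>0 \<le> t < T\<close> or \<open>1 \<le> i \<le> N\<close> are irrelevant.\<close>

definition particle_solution ::
  "real \<Rightarrow> real \<Rightarrow> nat \<Rightarrow> (nat \<Rightarrow> real) \<Rightarrow> (real \<Rightarrow> real \<Rightarrow> real) \<Rightarrow> (nat \<Rightarrow> real) \<Rightarrow>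
   ereal \<Rightarrow> (real \<Rightarrow> nat \<Rightarrow> real) \<Rightarrow> bool"
where
  "particle_solution s \<gamma> N \<zeta> \<sigma> x0 T x \<longleftrightarrow>
     0 < T \<and>
     (\<forall>i\<in>{1..N}. x 0 i = x0 i) \<and>
     (\<forall>i\<in>{1..N}. continuous_on {t. 0 \<le> t \<and> ereal t < T} (\<lambda>t. x t i)) \<and>
     (\<forall>t. 0 \<le> t \<and> ereal t < T \<longrightarrow> (\<forall>i\<in>{1..N}. \<forall>j\<in>{1..N}. i \<noteq> j \<longrightarrow> x t i \<noteq> x t j)) \<and>
     (\<forall>t. 0 < t \<and> ereal t < T \<longrightarrow>
        (\<forall>i\<in>{1..N}. ((\<lambda>r. x r i) has_real_derivative
            particle_velocity s \<gamma> N \<zeta> \<sigma> t (x t) i) (at t)))"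

text \<open>The collision time \<open>Tc\<close> of the trajectory \<open>x\<close> is the right end of its maximal interval of
  existence; \<open>Tc = \<infinity>\<close> means that there is no collision.\<close>

definition has_collision_time ::
  "real \<Rightarrow> real \<Rightarrow> nat \<Rightarrow> (nat \<Rightarrow> real) \<Rightarrow> (real \<Rightarrow> real \<Rightarrow> real) \<Rightarrow> (nat \<Rightarrow> real) \<Rightarrow>
   (real \<Rightarrow> nat \<Rightarrow> real) \<Rightarrow> ereal \<Rightarrow> bool"
where
  "has_collision_time s \<gamma> N \<zeta> \<sigma> x0 x Tc \<longleftrightarrow>
     particle_solution s \<gamma> N \<zeta> \<sigma> x0 Tc x \<and>
     \<not> (\<exists>T y. Tc < T \<and> particle_solution s \<gamma> N \<zeta> \<sigma> x0 T y \<and>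
              (\<forall>t. 0 \<le> t \<and> ereal t < Tc \<longrightarrow> (\<forall>i\<in>{1..N}. y t i = x t i)))"

end

theory Submission
  imports Defs
begin

text \<open>The gap \<open>\<theta> = x\<^sub>2 - x\<^sub>1\<close> satisfies
  \<open>\<theta>' = \<gamma> (\<sigma>(t, x\<^sub>1) + \<sigma>(t, x\<^sub>2) - \<theta> powr (- 2 s) / s)\<close>.  If \<open>\<sigma> \<le> 0\<close>, then
  \<open>\<theta> powr (2 s + 1)\<close> decreases at least linearly; for a small initial gap \<open>\<theta>\<close> never exceeds
  \<open>\<theta>\<^sub>0\<close> and itself decreases at least linearly.  The constant stress \<open>1 / (2 s)\<close> makes the pair at
  distance 1 stationary.

  The point where the equation for \<open>u\<close> enters is \<open>\<gamma> > 0\<close>: with the conventions for non-integrable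
  functions and for \<open>inverse 0\<close>, it requires \<open>u'\<close> to be square integrable.  Since \<open>u'\<close> is
  integrable, it suffices to bound it.  The increment \<open>w(x) = u(x + h) - u(x)\<close> has integral \<open>h\<close> and
  attains a maximum \<open>m\<close>, where \<open>I\<^sub>s[w] \<ge> - C m\<close> by the Lipschitz bound on \<open>W'\<close>, whereas
  \<open>I\<^sub>s[w] \<le> (h - m R) / (2 R) powr (1 + 2 s)\<close> for every \<open>R > 0\<close>.  A small fixed \<open>R\<close> gives
  \<open>m \<le> K h\<close> with \<open>K\<close> independent of \<open>h\<close>.\<close>

section \<open>Truncated integrals and increments for the nonlocal operator\<close>

lemma kernel_integrable:
  assumes "0 < s" "0 < \<epsilon>"
  shows "set_integrable lborel {y. \<epsilon> < \<bar>y\<bar>} (\<lambda>y::real. 1 / \<bar>y\<bar> powr (1 + 2 * s))"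
proof -
  \<comment> \<open>\<open>f\<close> is the right half of the kernel and its reflection supplies the
    left half. The endpoints that the closed ray adds are removed later by the strict
    truncation.\<close>
  define f where "f y = indicator {\<epsilon>..} y * y powr (-(1 + 2 * s))" for y :: real
  have "((\<lambda>y. y powr (-(1 + 2 * s))) has_integral -(\<epsilon> powr (-(1 + 2 * s) + 1)) / (-(1 + 2 * s) + 1)) {\<epsilon>..}"
    using assms by (intro has_integral_powr_to_inf) auto
  then have "set_integrable lebesgue {\<epsilon>..} (\<lambda>y. y powr (-(1 + 2 * s)))"
    by (intro nonnegative_absolutely_integrable_1) (auto simp: integrable_on_def)
  then have f: "integrable lborel f"
    unfolding set_integrable_def f_def
    by (subst (asm) integrable_completion) (auto simp: mult.commute)
  then have "integrable lborel (\<lambda>y. f (0 + (-1) * y))"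
    by (subst lborel_integrable_real_affine_iff) auto
  with f have "integrable lborel (\<lambda>y. f y + f (-y))" by auto
  then have "integrable lborel (\<lambda>y. indicator {y. \<epsilon> < \<bar>y\<bar>} y *\<^sub>R (f y + f (-y)))"
    by (intro integrable_mult_indicator) auto
  moreover have "indicator {y. \<epsilon> < \<bar>y\<bar>} y *\<^sub>R (f y + f (-y))
      = indicator {y. \<epsilon> < \<bar>y\<bar>} y *\<^sub>R (1 / \<bar>y\<bar> powr (1 + 2 * s))" for y
  proof (cases "\<epsilon> < \<bar>y\<bar>")
    case True
    then have "f y + f (-y) = \<bar>y\<bar> powr (-(1 + 2 * s))"
      using \<open>0 < \<epsilon>\<close> by (cases "0 < y") (auto simp: f_def indicator_def)
    then show ?thesis by (simp only: powr_minus_divide)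
  qed simp
  ultimately show ?thesis
    unfolding set_integrable_def by (simp only:)
qed

text \<open>A bounded numerator leaves a multiple of the kernel as dominating function. This is what
  permits two truncated operators to be subtracted under one integral sign, since the integral of a
  non-integrable function is 0 by convention.\<close>

lemma truncated_quotient_integrable:
  fixes \<phi> :: "real \<Rightarrow> real"
  assumes "0 < s" "0 < \<epsilon>" and cont: "continuous_on UNIV \<phi>" and bdd: "bounded (range \<phi>)"
  shows "set_integrable lborel {y. \<epsilon> < \<bar>y\<bar>} (\<lambda>y. (\<phi> (x + y) - \<phi> x) / \<bar>y\<bar> powr (1 + 2 * s))"
proof -
  obtain B where B: "\<bar>\<phi> z\<bar> \<le> B" for z
    using bdd by (auto simp: bounded_iff)
  have [measurable]: "\<phi> \<in> borel_measurable borel"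
    using cont by (rule borel_measurable_continuous_onI)
  have "\<bar>\<phi> (x + y) - \<phi> x\<bar> \<le> 2 * B" for y
    using B[of "x + y"] B[of x] by linarith
  note * = this
  have "set_integrable lborel {y. \<epsilon> < \<bar>y\<bar>} (\<lambda>y. 2 * B * (1 / \<bar>y\<bar> powr (1 + 2 * s)))"
    using kernel_integrable[OF assms(1,2)] by (rule set_integrable_mult_right)
  then show ?thesis
    unfolding set_integrable_def
    by (rule Bochner_Integration.integrable_bound)
      (use order_trans[OF * abs_ge_self] in \<open>auto simp: abs_mult indicator_def intro!: divide_right_mono\<close>)
qed

text \<open>After a shift of the variable the common part cancels: what remains is the integral of
  \<open>u\<close> over \<open>{b..b + h}\<close>, at most \<open>h\<close>, minus the one over
  \<open>{a..a + h}\<close>, which is nonnegative.\<close>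

lemma integral_increment_le:
  fixes u :: "real \<Rightarrow> real"
  assumes cont: "continuous_on UNIV u" and "0 \<le> h" "a \<le> b"
    and u: "\<And>x. 0 \<le> u x" "\<And>x. u x \<le> 1"
  shows "(LINT y:{a..b}|lborel. u (y + h) - u y) \<le> h"
proof -
  have int: "u integrable_on {c..d}" for c d
    by (rule integrable_continuous_real) (rule continuous_on_subset[OF cont subset_UNIV])
  have cont': "continuous_on {c..d} (\<lambda>y. u (y + k))" for c d k
    by (rule continuous_on_compose2[OF cont]) (auto intro!: continuous_intros)
  have int': "(\<lambda>y. u (y + h)) integrable_on {a..b}"
    by (rule integrable_continuous_real[OF cont'])
  have "(LINT y:{a..b}|lborel. u (y + h) - u y) = integral {a..b} (\<lambda>y. u (y + h) - u y)"
    by (intro set_borel_integral_eq_integral borel_integrable_atLeastAtMost' continuous_intros cont'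
        continuous_on_subset[OF cont]) auto
  also have "\<dots> = integral {a..b} (\<lambda>y. u (y + h)) - integral {a..b} u"
    by (rule Henstock_Kurzweil_Integration.integral_diff[OF int' int])
  also have "integral {a..b} (\<lambda>y. u (y + h)) = integral {a + h..b + h} u"
    using integral_shift[of a h b u] continuous_on_subset[OF cont] by (auto simp: o_def)
  \<comment> \<open>Both sides come from splitting \<open>{a..b + h}\<close>, once at
    \<open>a + h\<close> and once at \<open>b\<close>, so \<open>h\<close> may exceed
    \<open>b - a\<close>.\<close>
  also have "integral {a + h..b + h} u - integral {a..b} u
      = integral {b..b + h} u - integral {a..a + h} u"
    using Henstock_Kurzweil_Integration.integral_combine[of a "a + h" "b + h" u]
      Henstock_Kurzweil_Integration.integral_combine[of a b "b + h" u] assms int by auto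
  also have "\<dots> \<le> integral {b..b + h} (\<lambda>_. 1) - 0"
    by (intro diff_mono integral_le integral_nonneg int u) auto
  also have "\<dots> = h" using assms by simp
  finally show ?thesis .
qed

text \<open>The increment has mass at most \<open>h\<close>, so it falls well below a large maximum somewhere in
  \<open>[x + R, x + 2R]\<close>; this makes the nonlocal operator very negative there.\<close>

lemma frac_op_increment_at_max:
  fixes u :: "real \<Rightarrow> real"
  assumes "0 < s" "0 \<le> h" "0 < R"
    and cont: "continuous_on UNIV u" and u: "\<And>x. 0 \<le> u x" "\<And>x. u x \<le> 1"
    and L: "has_frac_op s u (x + h) L'" "has_frac_op s u x L"
    and max: "\<And>y. u (y + h) - u y \<le> u (x + h) - u x"
  shows "L' - L \<le> (h - (u (x + h) - u x) * R) / (2 * R) powr (1 + 2 * s)"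
proof -
  let ?p = "1 + 2 * s"
  define m where "m = u (x + h) - u x"
  have bdd: "bounded (range u)"
    using u by (auto simp: bounded_iff intro!: exI[of _ 1])
  have cont': "continuous_on A (\<lambda>y. u (y + k))" for A k
    by (rule continuous_on_compose2[OF cont]) (auto intro!: continuous_intros)
  have bound: "(LINT y:{y. \<epsilon> < \<bar>y\<bar>}|lborel. (u (x + h + y) - u (x + h)) / \<bar>y\<bar> powr ?p)
      - (LINT y:{y. \<epsilon> < \<bar>y\<bar>}|lborel. (u (x + y) - u x) / \<bar>y\<bar> powr ?p)
      \<le> (h - m * R) / (2 * R) powr ?p" if "0 < \<epsilon>" "\<epsilon> < R" for \<epsilon>
  proof -
    note int = truncated_quotient_integrable[OF \<open>0 < s\<close> \<open>0 < \<epsilon>\<close> cont bdd]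
    let ?g = "\<lambda>y. (u (x + y + h) - u (x + y) - m)"
    \<comment> \<open>The two difference quotients combine into that of the increment of
      \<open>u\<close> at \<open>x\<close>. Its numerator \<open>?g\<close> is nonpositive because
      \<open>m\<close> is the maximal increment.\<close>
    have eq: "(u (x + h + y) - u (x + h)) / \<bar>y\<bar> powr ?p - (u (x + y) - u x) / \<bar>y\<bar> powr ?p
        = ?g y / \<bar>y\<bar> powr ?p" for y
      unfolding m_def by (simp add: diff_divide_distrib[symmetric] algebra_simps)
    have int1: "set_integrable lborel {y. \<epsilon> < \<bar>y\<bar>} (\<lambda>y. ?g y / \<bar>y\<bar> powr ?p)"
      using set_integral_diff(1)[OF int[of "x + h"] int[of x]] unfolding eq .
    have c1: "continuous_on {R..2 * R} (\<lambda>y. u (y + (x + h)) - u (y + x))"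
      by (intro continuous_intros cont')
    have int_w: "set_integrable lborel {R..2 * R} (\<lambda>y. u (y + (x + h)) - u (y + x))"
      by (rule borel_integrable_atLeastAtMost'[OF c1])
    have int2: "set_integrable lborel {R..2 * R} (\<lambda>y. u (y + (x + h)) - u (y + x) - m)"
      by (intro borel_integrable_atLeastAtMost' continuous_intros c1)
    have int2': "set_integrable lborel {R..2 * R} (\<lambda>y. ?g y / (2 * R) powr ?p)"
      using int2 by (simp add: algebra_simps)
    have "(LINT y:{y. \<epsilon> < \<bar>y\<bar>}|lborel. (u (x + h + y) - u (x + h)) / \<bar>y\<bar> powr ?p)
      - (LINT y:{y. \<epsilon> < \<bar>y\<bar>}|lborel. (u (x + y) - u x) / \<bar>y\<bar> powr ?p)
      = (LINT y:{y. \<epsilon> < \<bar>y\<bar>}|lborel. ?g y / \<bar>y\<bar> powr ?p)"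
      using set_integral_diff(2)[OF int[of "x + h"] int[of x]] unfolding eq by simp
    \<comment> \<open>Discarding the nonpositive integrand off \<open>{R..2 * R}\<close> only
      increases the integral. On that interval, which lies in the truncated domain as \<epsilon> <
      R, the kernel is replaced by its least value.\<close>
    also have "\<dots> \<le> (LINT y:{R..2 * R}|lborel. ?g y / (2 * R) powr ?p)"
      unfolding set_lebesgue_integral_def
    proof (rule integral_mono)
      show "indicator {y. \<epsilon> < \<bar>y\<bar>} y *\<^sub>R (?g y / \<bar>y\<bar> powr ?p)
          \<le> indicator {R..2 * R} y *\<^sub>R (?g y / (2 * R) powr ?p)" for y
      proof (cases "y \<in> {R..2 * R}")
        case True
        have "?g y \<le> 0" using max[of "x + y"] by (simp add: m_def)
        moreover have "\<bar>y\<bar> powr ?p \<le> (2 * R) powr ?p"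
          using True assms by (intro powr_mono2) auto
        moreover have "0 < \<bar>y\<bar> powr ?p" using True assms by auto
        ultimately have "?g y / \<bar>y\<bar> powr ?p \<le> ?g y / (2 * R) powr ?p"
          using \<open>0 < R\<close> by (intro divide_left_mono_neg mult_pos_pos) auto
        then show ?thesis using True that by simp
      next
        case False
        have "?g y \<le> 0" using max[of "x + y"] by (simp add: m_def)
        then show ?thesis using False by (auto simp: indicator_def divide_nonpos_nonneg)
      qed
    qed (use int1 int2' in \<open>auto simp: set_integrable_def\<close>)
    also have "\<dots> = (LINT y:{R..2 * R}|lborel. u (y + (x + h)) - u (y + x) - m) / (2 * R) powr ?p"
      by (simp add: algebra_simps)
    also have "(LINT y:{R..2 * R}|lborel. u (y + (x + h)) - u (y + x) - m)
        = (LINT y:{R..2 * R}|lborel. u (y + (x + h)) - u (y + x)) - m * R"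
      using \<open>0 < R\<close> by (subst set_integral_diff(2)[OF int_w]) (auto simp: set_integral_const intro!: borel_integrable_atLeastAtMost')
    also have "(LINT y:{R..2 * R}|lborel. u (y + (x + h)) - u (y + x)) \<le> h"
      using integral_increment_le[of "\<lambda>y. u (y + x)" h R "2 * R"] cont' u assms
      by (simp add: algebra_simps)
    finally show ?thesis by (simp add: divide_right_mono)
  qed
  have "((\<lambda>\<epsilon>. (LINT y:{y. \<epsilon> < \<bar>y\<bar>}|lborel. (u (x + h + y) - u (x + h)) / \<bar>y\<bar> powr ?p)
      - (LINT y:{y. \<epsilon> < \<bar>y\<bar>}|lborel. (u (x + y) - u x) / \<bar>y\<bar> powr ?p)) \<longlongrightarrow> L' - L) (at_right 0)"
    using L unfolding has_frac_op_def by (intro tendsto_diff)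
  moreover have "\<forall>\<^sub>F \<epsilon> in at_right 0.
      (LINT y:{y. \<epsilon> < \<bar>y\<bar>}|lborel. (u (x + h + y) - u (x + h)) / \<bar>y\<bar> powr ?p)
      - (LINT y:{y. \<epsilon> < \<bar>y\<bar>}|lborel. (u (x + y) - u x) / \<bar>y\<bar> powr ?p)
      \<le> (h - m * R) / (2 * R) powr ?p"
    unfolding eventually_at_right_field using bound \<open>0 < R\<close> by blast
  ultimately show ?thesis
    unfolding m_def by (rule tendsto_upperbound) simp
qed

text \<open>The increment at 0 is positive, whereas far out \<open>u\<close> is so close to its
  limits that no increment exceeds this value. Hence the maximum over a compact interval is
  global.\<close>

lemma increment_attains_max:
  fixes u :: "real \<Rightarrow> real"
  assumes cont: "continuous_on UNIV u" and mono: "strict_mono u"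
    and lim: "(u \<longlongrightarrow> 0) at_bot" "(u \<longlongrightarrow> 1) at_top"
    and u: "\<And>x. 0 \<le> u x" "\<And>x. u x \<le> 1" and "0 < h"
  obtains x where "\<And>y. u (y + h) - u y \<le> u (x + h) - u x"
proof -
  define w where "w y = u (y + h) - u y" for y
  have w0: "w 0 > 0" using mono \<open>0 < h\<close> by (simp add: w_def strict_mono_less)
  obtain a where a: "\<And>y. y \<le> a \<Longrightarrow> u y < w 0"
    using order_tendstoD(2)[OF lim(1) w0] by (auto simp: eventually_at_bot_linorder)
  obtain b where b: "\<And>y. y \<ge> b \<Longrightarrow> 1 - w 0 < u y"
    using order_tendstoD(1)[OF lim(2), of "1 - w 0"] w0 by (auto simp: eventually_at_top_linorder)
  \<comment> \<open>The extra \<open>h\<close> on the left is there because the increment at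
    \<open>y\<close> involves \<open>y + h\<close>, which has to stay below
    \<open>a\<close>.\<close>
  define B where "B = max (\<bar>a\<bar> + h) \<bar>b\<bar>"
  have "continuous_on {-B..B} w"
    unfolding w_def
    by (intro continuous_intros continuous_on_compose2[OF cont, of _ "\<lambda>y. y + h"]
        continuous_on_subset[OF cont]) auto
  moreover have "0 \<in> {-B..B}" by (auto simp: B_def)
  ultimately obtain x where x: "x \<in> {-B..B}" "\<And>y. y \<in> {-B..B} \<Longrightarrow> w y \<le> w x"
    using continuous_attains_sup[of "{-B..B}" w] by (metis compact_Icc empty_iff)
  have "w y \<le> w x" for y
  proof (cases "y \<in> {-B..B}")
    case False
    then consider "y + h \<le> a" | "y \<ge> b" using \<open>0 < h\<close> unfolding B_def by (auto simp: max_def split: if_splits)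
    then have "w y \<le> w 0"
    proof cases
      case 1 then show ?thesis using a[of "y + h"] u(1)[of y] unfolding w_def by linarith
    next
      case 2 then show ?thesis using b[of y] u(2)[of "y + h"] unfolding w_def by linarith
    qed
    also have "\<dots> \<le> w x" by (rule x(2)) fact
    finally show ?thesis .
  qed (rule x(2))
  then show ?thesis using that unfolding w_def by blast
qed

section \<open>Bounded derivative of the layer solution and positivity of \<gamma>\<close>

lemma layer_solution_regular:
  assumes "layer_solution s W u"
  shows "\<And>x. (u has_real_derivative deriv u x) (at x)" "\<And>x. isCont (deriv u) x" "\<And>x. deriv u x > 0"
    "strict_mono u" "\<And>x. 0 \<le> u x" "\<And>x. u x \<le> 1"
proof -
  have C: "C_class 2 u" and pos: "\<And>x. deriv u x > 0"
    and lim: "(u \<longlongrightarrow> 0) at_bot" "(u \<longlongrightarrow> 1) at_top"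
    using assms by (auto simp: layer_solution_def)
  have "\<forall>j<2. \<forall>x. (deriv ^^ j) u differentiable at x" using C by (simp add: C_class_def)
  from this[rule_format, of 0] this[rule_format, of 1]
  have d: "u differentiable at x" "deriv u differentiable at x" for x by auto
  show D: "(u has_real_derivative deriv u x) (at x)" for x
    using d(1) by (simp add: DERIV_deriv_iff_real_differentiable)
  show "isCont (deriv u) x" for x
    using d(2) by (rule differentiable_imp_continuous_within)
  show "deriv u x > 0" for x by (rule pos)
  show mono: "strict_mono u"
  proof (rule strict_monoI)
    show "u x < u y" if "x < y" for x y
      by (rule DERIV_pos_imp_increasing[OF that]) (meson D pos)
  qed
  show "0 \<le> u x" for x
    by (rule tendsto_upperbound[OF lim(1)])
      (auto simp: eventually_at_bot_linorder strict_mono_less_eq[OF mono])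
  show "u x \<le> 1" for x
    by (rule tendsto_lowerbound[OF lim(2)])
      (auto simp: eventually_at_top_linorder strict_mono_less_eq[OF mono])
qed

text \<open>The Hoelder class includes a bound on the second derivative, which serves as global
  Lipschitz constant.\<close>

lemma multiwell_deriv_lipschitz:
  assumes "multiwell_potential W"
  obtains C where "0 \<le> C" "\<And>a b. \<bar>deriv W b - deriv W a\<bar> \<le> C * \<bar>b - a\<bar>"
proof -
  obtain \<alpha> where H: "holder_class 3 \<alpha> W" using assms by (auto simp: multiwell_potential_def)
  have diff: "\<forall>j<3. \<forall>x. (deriv ^^ j) W differentiable at x"
    and bdd: "\<forall>j\<le>3. bounded (range ((deriv ^^ j) W))"
    using H by (auto simp: holder_class_def C_class_def)
  have D: "(deriv W has_real_derivative (deriv ^^ 2) W x) (at x)" for x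
    using diff[rule_format, of 1 x] by (simp add: DERIV_deriv_iff_real_differentiable numeral_2_eq_2)
  obtain C where C: "\<And>x. \<bar>(deriv ^^ 2) W x\<bar> \<le> C"
    using bdd[rule_format, of 2] by (auto simp: bounded_iff)
  have "\<bar>deriv W b - deriv W a\<bar> \<le> C * \<bar>b - a\<bar>" for a b
    using field_differentiable_bound[of UNIV "deriv W" "(deriv ^^ 2) W" C b a] D C
    by (simp add: has_field_derivative_at_within)
  moreover have "0 \<le> C" using C[of 0] by linarith
  ultimately show thesis by (rule that[rotated])
qed

lemma layer_deriv_bounded:
  assumes "0 < s" "multiwell_potential W" and layer: "layer_solution s W u"
  obtains K where "\<And>x. deriv u x \<le> K"
proof -
  note reg = layer_solution_regular[OF layer]
  have lim: "(u \<longlongrightarrow> 0) at_bot" "(u \<longlongrightarrow> 1) at_top"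
    and op: "\<And>x. has_frac_op s u x (deriv W (u x))"
    using layer by (auto simp: layer_solution_def)
  have cont: "continuous_on UNIV u"
    using reg(1) by (intro DERIV_continuous_on) (auto intro: has_field_derivative_at_within)
  obtain C where "0 \<le> C" and C: "\<And>a b. \<bar>deriv W b - deriv W a\<bar> \<le> C * \<bar>b - a\<bar>"
    using multiwell_deriv_lipschitz[OF assms(2)] by blast
  let ?p = "1 + 2 * s"
  \<comment> \<open>This \<open>R\<close> solves \<open>R * K = C + 1\<close>. The nonlocal term
    then outweighs the Lipschitz term \<open>C * ?m\<close> by exactly \<open>?m\<close>, which
    leaves \<open>?m \<le> K * h\<close>.\<close>
  define R where "R = ((C + 1) * 2 powr ?p) powr (-1 / (2 * s))"
  define K where "K = 1 / (2 * R) powr ?p"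
  have "0 < R" using \<open>0 \<le> C\<close> unfolding R_def by auto
  have "R powr (-2 * s) = (C + 1) * 2 powr ?p"
    using \<open>0 < s\<close> \<open>0 \<le> C\<close> unfolding R_def powr_powr by simp
  moreover have "R / (2 * R) powr ?p = R powr (-2 * s) / 2 powr ?p"
    using \<open>0 < R\<close> by (simp add: powr_mult powr_add powr_minus field_simps)
  ultimately have R: "R * K = C + 1" unfolding K_def by simp
  have "0 < K" using \<open>0 < R\<close> unfolding K_def by simp
  have inc: "u (y + h) - u y \<le> K * h" if "0 < h" for h y
  proof -
    obtain x where x: "\<And>y. u (y + h) - u y \<le> u (x + h) - u x"
      using increment_attains_max[OF cont reg(4) lim reg(5,6) \<open>0 < h\<close>] by blast
    let ?m = "u (x + h) - u x"
    have "0 \<le> ?m" using reg(4) that by (simp add: strict_mono_less_eq)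
    have "- (C * ?m) \<le> deriv W (u (x + h)) - deriv W (u x)"
      using C[of "u (x + h)" "u x"] \<open>0 \<le> ?m\<close> by simp
    also have "\<dots> \<le> (h - ?m * R) / (2 * R) powr ?p"
      using that \<open>0 < R\<close> \<open>0 < s\<close> by (intro frac_op_increment_at_max cont reg(5,6) op x) auto
    also have "\<dots> = K * h - ?m * (R * K)" by (simp add: K_def diff_divide_distrib)
    finally have "?m \<le> K * h" unfolding R by (simp add: algebra_simps)
    with x[of y] show ?thesis by linarith
  qed
  \<comment> \<open>\<open>K\<close> does not depend on \<open>h\<close>, and since the derivative
    exists, right difference quotients suffice.\<close>
  have "deriv u x \<le> K" for x
  proof (rule tendsto_upperbound)
    show "((\<lambda>h. (u (x + h) - u x) / h) \<longlongrightarrow> deriv u x) (at_right 0)"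
      using reg(1)[of x] unfolding DERIV_def by (rule Lim_at_imp_Lim_at_within)
    show "\<forall>\<^sub>F h in at_right 0. (u (x + h) - u x) / h \<le> K"
      unfolding eventually_at_right_field using inc
      by (intro exI[of _ 1]) (simp add: pos_divide_le_eq)
  qed simp
  then show thesis by (rule that)
qed

text \<open>By convention \<open>layer_const\<close> would be 0 if the integral diverged or
  vanished, so both are excluded: the first by comparing the square of \<open>deriv u\<close> with
  \<open>K * deriv u\<close>, the second by strict positivity of \<open>deriv u\<close>.\<close>

lemma layer_const_pos:
  assumes "0 < s" "multiwell_potential W" and layer: "layer_solution s W u"
  shows "0 < layer_const u"
proof -
  note reg = layer_solution_regular[OF layer]
  have lim: "(u \<longlongrightarrow> 0) at_bot" "(u \<longlongrightarrow> 1) at_top"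
    using layer by (auto simp: layer_solution_def)
  obtain K where K: "\<And>x. deriv u x \<le> K" using layer_deriv_bounded[OF assms] by blast
  have [measurable]: "deriv u \<in> borel_measurable borel"
    using reg(2) by (intro borel_measurable_continuous_onI) (simp add: continuous_at_imp_continuous_on)
  \<comment> \<open>The derivative is nonnegative and \<open>u\<close> has finite limits at both
    ends, so the fundamental theorem of calculus on the whole line gives integrability.\<close>
  have "set_integrable lborel (einterval (-\<infinity>) \<infinity>) (deriv u)"
    by (rule interval_integral_FTC_nonneg(1)[where F = u and A = 0 and B = 1])
      (use reg lim in \<open>auto simp: ereal_tendsto_simps less_imp_le\<close>)
  then have int: "integrable lborel (deriv u)" by (simp add: set_integrable_def)
  have int2: "integrable lborel (\<lambda>x. (deriv u x)\<^sup>2)"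
  proof (rule Bochner_Integration.integrable_bound)
    show "integrable lborel (\<lambda>x. K * deriv u x)" using int by simp
    have "(deriv u x)\<^sup>2 \<le> K * deriv u x" for x
      using K[of x] reg(3)[of x] by (simp add: power2_eq_square)
    then show "AE x in lborel. norm ((deriv u x)\<^sup>2) \<le> norm (K * deriv u x)"
      by (auto intro!: AE_I2 order_trans[OF _ abs_ge_self])
  qed measurable
  have "(\<integral>x. (deriv u x)\<^sup>2 \<partial>lborel) \<noteq> 0"
  proof
    assume "(\<integral>x. (deriv u x)\<^sup>2 \<partial>lborel) = 0"
    then have "AE x in lborel. (deriv u x)\<^sup>2 = 0"
      using int2 by (subst (asm) integral_nonneg_eq_0_iff_AE) auto
    moreover have "(deriv u x)\<^sup>2 \<noteq> 0" for x using reg(3)[of x] by simp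
    ultimately have "AE x in (lborel :: real measure). False" by simp
    then show False using emeasure_lborel_UNIV by (simp add: AE_iff_null null_sets_def)
  qed
  moreover have "(\<integral>x. (deriv u x)\<^sup>2 \<partial>lborel) \<ge> 0" by simp
  ultimately show ?thesis unfolding layer_const_def by (simp add: less_le del: integral_nonneg)
qed


section \<open>The gap equation for two particles of opposite sign\<close>

lemma le_supnorm:
  assumes "bounded_stress f" "0 \<le> t"
  shows "\<bar>f t x\<bar> \<le> supnorm f"
proof -
  obtain B where B: "\<And>t x. 0 \<le> t \<Longrightarrow> \<bar>f t x\<bar> \<le> B"
    using assms(1) by (auto simp: bounded_stress_def bounded_iff)
  have "bdd_above ((\<lambda>(t, x). \<bar>f t x\<bar>) ` ({0..} \<times> UNIV))"
    using B by (intro bdd_aboveI2[of _ _ B]) auto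
  then show ?thesis
    unfolding supnorm_def using cSUP_upper[of "(t, x)" "{0..} \<times> UNIV" "\<lambda>(t, x). \<bar>f t x\<bar>"] assms(2) by simp
qed

lemma supnorm_const: "supnorm (\<lambda>t x. c) = \<bar>c\<bar>"
  by (simp add: supnorm_def case_prod_unfold cSUP_const)

text \<open>Opposite signs attract, and each particle contributes half of the singular term. Since
  the stress acts with opposite signs on the two particles, its two values add up in the difference
  of the velocities.\<close>

lemma particle_gap:
  assumes "particle_solution s \<gamma> 2 \<zeta> \<sigma> x0 T x" "\<zeta> 1 = 1" "\<zeta> 2 = -1" "x0 1 < x0 2" "0 < s"
  defines "\<theta> \<equiv> \<lambda>t. x t 2 - x t 1"
  shows "\<theta> 0 = x0 2 - x0 1"
    and "continuous_on {t. 0 \<le> t \<and> ereal t < T} \<theta>"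
    and "\<And>t. 0 \<le> t \<Longrightarrow> ereal t < T \<Longrightarrow> 0 < \<theta> t"
    and "\<And>t. 0 < t \<Longrightarrow> ereal t < T \<Longrightarrow> (\<theta> has_real_derivative
           \<gamma> * (\<sigma> t (x t 1) + \<sigma> t (x t 2) - \<theta> t powr (- 2 * s) / s)) (at t)"
proof -
  have init: "\<And>i. i \<in> {1..2} \<Longrightarrow> x 0 i = x0 i"
    and cont: "\<And>i. i \<in> {1..2} \<Longrightarrow> continuous_on {t. 0 \<le> t \<and> ereal t < T} (\<lambda>t. x t i)"
    and neq: "\<And>t. 0 \<le> t \<Longrightarrow> ereal t < T \<Longrightarrow> x t 2 \<noteq> x t 1"
    and der: "\<And>t i. 0 < t \<Longrightarrow> ereal t < T \<Longrightarrow> i \<in> {1..2} \<Longrightarrow>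
        ((\<lambda>r. x r i) has_real_derivative particle_velocity s \<gamma> 2 \<zeta> \<sigma> t (x t) i) (at t)"
    using assms(1) by (auto simp: particle_solution_def)
  show \<theta>0: "\<theta> 0 = x0 2 - x0 1" by (simp add: \<theta>_def init)
  show c: "continuous_on {t. 0 \<le> t \<and> ereal t < T} \<theta>"
    unfolding \<theta>_def by (intro continuous_intros cont) auto
  show pos: "0 < \<theta> t" if "0 \<le> t" "ereal t < T" for t
  \<comment> \<open>A nonpositive gap would force a zero at some time in between, that is, a
    collision before \<open>T\<close>.\<close>
  proof (rule ccontr)
    assume "\<not> 0 < \<theta> t"
    have "ereal r < T" if "r \<le> t" for r
      using that \<open>ereal t < T\<close> by (meson ereal_less_eq(3) le_less_trans)
    then have "continuous_on {0..t} \<theta>"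
      by (intro continuous_on_subset[OF c]) auto
    then obtain r where "0 \<le> r" "r \<le> t" "\<theta> r = 0"
      using IVT2'[of \<theta> t 0 0] \<open>\<not> 0 < \<theta> t\<close> \<theta>0 assms(4) \<open>0 \<le> t\<close> by auto
    then show False
      using neq[of r] \<open>\<And>r. r \<le> t \<Longrightarrow> ereal r < T\<close> by (auto simp: \<theta>_def)
  qed
  fix t assume t: "0 < t" "ereal t < T"
  have sets: "{1..2} - {1} = {2::nat}" "{1..2} - {2} = {1::nat}" by auto
  have \<theta>t: "0 < \<theta> t" using pos t by auto
  have q: "\<theta> t / (2 * s * \<theta> t powr (1 + 2 * s)) = \<theta> t powr (- 2 * s) / (2 * s)"
    using \<theta>t by (simp add: powr_add powr_minus field_simps)
  have a: "\<bar>x t 1 - x t 2\<bar> = \<theta> t" "\<bar>x t 2 - x t 1\<bar> = \<theta> t"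
      "x t 1 - x t 2 = - \<theta> t" "x t 2 - x t 1 = \<theta> t" "\<bar>\<theta> t\<bar> = \<theta> t"
    using \<theta>t by (auto simp: \<theta>_def)
  have v: "particle_velocity s \<gamma> 2 \<zeta> \<sigma> t (x t) 1 = \<gamma> * (\<theta> t powr (- 2 * s) / (2 * s) - \<sigma> t (x t 1))"
      "particle_velocity s \<gamma> 2 \<zeta> \<sigma> t (x t) 2 = \<gamma> * (\<sigma> t (x t 2) - \<theta> t powr (- 2 * s) / (2 * s))"
    unfolding particle_velocity_def sets by (simp_all add: assms(2,3) a(1-4) del: One_nat_def) (simp_all only: a(5) q minus_mult_left, simp_all)
  have "(\<theta> has_real_derivative
      (\<gamma> * (\<sigma> t (x t 2) - \<theta> t powr (- 2 * s) / (2 * s)))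
      - \<gamma> * (\<theta> t powr (- 2 * s) / (2 * s) - \<sigma> t (x t 1))) (at t)"
    unfolding \<theta>_def[abs_def] using der[OF t, of 1] der[OF t, of 2] unfolding v
    by (intro DERIV_diff) (auto simp: \<theta>_def)
  then show "(\<theta> has_real_derivative
      \<gamma> * (\<sigma> t (x t 1) + \<sigma> t (x t 2) - \<theta> t powr (- 2 * s) / s)) (at t)"
    using \<open>0 < s\<close> by (elim DERIV_cong) (simp add: field_simps)
qed

section \<open>Comparison arguments for scalar functions\<close>

text \<open>If \<open>T\<close> were larger, finite or not, the mean value theorem on the interval
  from 0 to \<open>f 0 / k\<close> would make \<open>f\<close> nonpositive at its right end.\<close>

lemma extinction_time_bound:
  fixes f f' :: "real \<Rightarrow> real" and T :: ereal
  assumes cont: "continuous_on {t. 0 \<le> t \<and> ereal t < T} f"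
    and pos: "\<And>t. 0 \<le> t \<Longrightarrow> ereal t < T \<Longrightarrow> 0 < f t"
    and der: "\<And>t. 0 < t \<Longrightarrow> ereal t < T \<Longrightarrow> (f has_real_derivative f' t) (at t)"
    and le: "\<And>t. 0 < t \<Longrightarrow> ereal t < T \<Longrightarrow> f' t \<le> - k"
    and "0 < k" "0 < T"
  shows "T \<le> ereal (f 0 / k)"
proof (rule ccontr)
  define t where "t = f 0 / k"
  assume "\<not> T \<le> ereal (f 0 / k)"
  then have tT: "ereal t < T" by (simp add: t_def)
  have "0 < f 0" using pos[of 0] \<open>0 < T\<close> by (simp add: zero_ereal_def)
  then have "0 < t" using \<open>0 < k\<close> by (simp add: t_def)
  have T: "ereal r < T" if "r \<le> t" for r
    using that tT by (meson ereal_less_eq(3) le_less_trans)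
  have "continuous_on {0..t} f" using T by (intro continuous_on_subset[OF cont]) auto
  moreover have "f differentiable at z" if "0 < z" "z < t" for z
    using der[of z] T[of z] that by (auto simp: real_differentiable_def)
  ultimately obtain l z where
    lz: "0 < z" "z < t" "(f has_real_derivative l) (at z)" "f t - f 0 = (t - 0) * l"
    using MVT[OF \<open>0 < t\<close>, of f] by blast
  then have z: "0 < z" "z < t" "f t - f 0 = t * f' z"
    using DERIV_unique[OF lz(3) der[of z]] T[of z] by auto
  have "t * f' z \<le> t * - k" using z le[of z] T[of z] \<open>0 < t\<close> by (intro mult_left_mono) auto
  then have "f t \<le> 0" using z(3) \<open>0 < k\<close> by (simp add: t_def)
  with pos[of t] tT \<open>0 < t\<close> show False by simp
qed

text \<open>At the first time a level just above \<open>f 0\<close> is reached, the derivative would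
  have to be nonnegative. The barrier makes it negative there.\<close>

lemma stays_below:
  fixes f f' :: "real \<Rightarrow> real" and T :: ereal
  assumes cont: "continuous_on {t. 0 \<le> t \<and> ereal t < T} f"
    and der: "\<And>t. 0 < t \<Longrightarrow> ereal t < T \<Longrightarrow> (f has_real_derivative f' t) (at t)"
    and barrier: "\<And>t. 0 < t \<Longrightarrow> ereal t < T \<Longrightarrow> f 0 < f t \<Longrightarrow> f t < c \<Longrightarrow> f' t < 0"
    and "f 0 < c" and t: "0 \<le> t" "ereal t < T"
  shows "f t \<le> f 0"
proof (rule ccontr)
  assume "\<not> f t \<le> f 0"
  \<comment> \<open>The sign of the derivative is known only strictly between \<open>f 0\<close> and
    \<open>c\<close>, so the level \<open>d\<close> is taken inside that range.\<close>
  then obtain d where d: "f 0 < d" "d < c" "d < f t"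
    using dense[of "f 0" "min c (f t)"] \<open>f 0 < c\<close> by auto
  have T: "ereal r < T" if "r \<le> t" for r
    using that t(2) by (meson ereal_less_eq(3) le_less_trans)
  have c: "continuous_on {0..t} f" using T by (intro continuous_on_subset[OF cont]) auto
  define S where "S = {0..t} \<inter> f -` {d}"
  have "compact S"
    unfolding S_def compact_eq_bounded_closed
    by (intro conjI continuous_closed_preimage[OF c] bounded_subset[OF bounded_closed_interval[of 0 t]]) auto
  moreover have "S \<noteq> {}"
    using IVT'[of f 0 d t] d t(1) c by (auto simp: S_def)
  ultimately obtain r where r: "r \<in> S" "\<And>r'. r' \<in> S \<Longrightarrow> r \<le> r'"
    using compact_attains_inf by metis
  have "0 < r" "r \<le> t" "f r = d" using r(1) d by (auto simp: S_def less_le)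
  have "f' r < 0" using barrier[of r] T[of r] \<open>0 < r\<close> \<open>r \<le> t\<close> \<open>f r = d\<close> d by auto
  with der[of r] T[of r] \<open>0 < r\<close> \<open>r \<le> t\<close> obtain e where
    e: "0 < e" "\<And>h. 0 < h \<Longrightarrow> h < e \<Longrightarrow> f r < f (r - h)"
    using has_real_derivative_neg_dec_left[of f "f' r" r UNIV] by auto
  \<comment> \<open>Just before the first crossing time \<open>r\<close> the function already lies
    above \<open>d\<close>, so it has crossed \<open>d\<close> even earlier.\<close>
  obtain h where h: "0 < h" "h < e" "h < r" using dense[of 0 "min e r"] e(1) \<open>0 < r\<close> by auto
  then have "d < f (r - h)" using e(2) \<open>f r = d\<close> by auto
  moreover have "continuous_on {0..r - h} f"
    by (rule continuous_on_subset[OF c]) (use \<open>r \<le> t\<close> h in auto)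
  ultimately obtain r' where "0 \<le> r'" "r' \<le> r - h" "f r' = d"
    using IVT'[of f 0 d "r - h"] d h by auto
  then show False using r(2)[of r'] \<open>r \<le> t\<close> h by (auto simp: S_def)
qed

section \<open>Upper bounds for the collision time\<close>

text \<open>The exponent \<open>2 * s + 1\<close> is the one for which the chain rule factor
  \<open>\<theta> t powr (2 * s)\<close> cancels the singularity, so the attraction alone gives a
  constant rate of decrease.\<close>

lemma collision_time_nonpos_stress:
  assumes sol: "particle_solution s \<gamma> 2 \<zeta> \<sigma> x0 T x" "\<zeta> 1 = 1" "\<zeta> 2 = -1" "x0 1 < x0 2" "0 < s"
    and "0 < \<gamma>" and \<sigma>: "\<And>t z. 0 \<le> t \<Longrightarrow> \<sigma> t z \<le> 0"
  shows "T \<le> ereal (s * (x0 2 - x0 1) powr (2 * s + 1) / ((2 * s + 1) * \<gamma>))"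
proof -
  define \<theta> where "\<theta> t = x t 2 - x t 1" for t
  note gap = particle_gap[OF sol, folded \<theta>_def]
  have "0 < T" using sol(1) by (simp add: particle_solution_def)
  let ?p = "2 * s + 1"
  let ?v = "\<lambda>t. \<gamma> * (\<sigma> t (x t 1) + \<sigma> t (x t 2) - \<theta> t powr (- 2 * s) / s)"
  have "T \<le> ereal (\<theta> 0 powr ?p / (?p * \<gamma> / s))"
  proof (rule extinction_time_bound)
    show "continuous_on {t. 0 \<le> t \<and> ereal t < T} (\<lambda>t. \<theta> t powr ?p)"
      by (intro continuous_on_powr gap(2) continuous_intros) (use gap(3) in fastforce)
    show "0 < \<theta> t powr ?p" if "0 \<le> t" "ereal t < T" for t
      using gap(3)[OF that] by simp
    fix t assume t: "0 < t" "ereal t < T"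
    have pos: "0 < \<theta> t" using gap(3) t by auto
    show "((\<lambda>t. \<theta> t powr ?p) has_real_derivative ?p * \<theta> t powr (2 * s) * ?v t) (at t)"
      using DERIV_fun_powr[OF gap(4)[OF t] pos, of ?p] by simp
    have "?v t \<le> \<gamma> * (0 - \<theta> t powr (- 2 * s) / s)"
      using \<sigma>[of t "x t 1"] \<sigma>[of t "x t 2"] t \<open>0 < \<gamma>\<close> by (intro mult_left_mono) auto
    then have "?p * \<theta> t powr (2 * s) * ?v t
        \<le> ?p * \<theta> t powr (2 * s) * (\<gamma> * (0 - \<theta> t powr (- 2 * s) / s))"
      by (rule mult_left_mono) (use \<open>0 < s\<close> in simp)
    also have "\<dots> = - (?p * \<gamma> / s)"
      using pos \<open>0 < s\<close> by (simp add: powr_minus divide_simps)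
    finally show "?p * \<theta> t powr (2 * s) * ?v t \<le> - (?p * \<gamma> / s)" .
  qed (use \<open>0 < s\<close> \<open>0 < \<gamma>\<close> \<open>0 < T\<close> in auto)
  then show ?thesis by (simp add: gap(1) mult.commute)
qed

text \<open>Smallness says that at the initial gap the attraction beats the largest possible stress.
  The gap then cannot grow, so the attraction never weakens and the initial closing rate remains a
  lower bound.\<close>

lemma collision_time_small_gap:
  assumes sol: "particle_solution s \<gamma> 2 \<zeta> \<sigma> x0 T x" "\<zeta> 1 = 1" "\<zeta> 2 = -1" "x0 1 < x0 2" "0 < s"
    and "0 < \<gamma>" and \<sigma>: "\<And>t z. 0 \<le> t \<Longrightarrow> \<bar>\<sigma> t z\<bar> \<le> S"
    and \<theta>0: "\<theta>0 = x0 2 - x0 1" and small: "2 * s * \<theta>0 powr (2 * s) * S < 1"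
  shows "T \<le> ereal (s * \<theta>0 powr (1 + 2 * s) / (\<gamma> * (1 - 2 * s * \<theta>0 powr (2 * s) * S)))"
proof -
  define \<theta> where "\<theta> t = x t 2 - x t 1" for t
  note gap = particle_gap[OF sol, folded \<theta>_def]
  have "0 < T" using sol(1) by (simp add: particle_solution_def)
  have "0 < \<theta>0" using sol(4) \<theta>0 by simp
  have init: "\<theta> 0 = \<theta>0" using gap(1) \<theta>0 by simp
  have "0 \<le> S" using \<sigma>[of 0 0] by simp
  let ?v = "\<lambda>t. \<gamma> * (\<sigma> t (x t 1) + \<sigma> t (x t 2) - \<theta> t powr (- 2 * s) / s)"
  have v_le: "?v t \<le> \<gamma> * (2 * S - \<theta> t powr (- 2 * s) / s)" if "0 < t" for t
    using \<sigma>[of t "x t 1"] \<sigma>[of t "x t 2"] that \<open>0 < \<gamma>\<close> by (intro mult_left_mono) auto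
  \<comment> \<open>The barrier argument needs the sign of the velocity slightly above \<theta>0 as
    well. Continuity extends the strict inequality to gaps up to some \<open>c\<close>.\<close>
  have "((\<lambda>r. 2 * s * r powr (2 * s) * S) \<longlongrightarrow> 2 * s * \<theta>0 powr (2 * s) * S) (at_right \<theta>0)"
    using \<open>0 < \<theta>0\<close> by (intro tendsto_intros) auto
  then have "\<forall>\<^sub>F r in at_right \<theta>0. 2 * s * r powr (2 * s) * S < 1"
    using small by (rule order_tendstoD)
  then obtain c where c: "\<theta>0 < c" "\<And>r. \<theta>0 < r \<Longrightarrow> r < c \<Longrightarrow> 2 * s * r powr (2 * s) * S < 1"
    by (auto simp: eventually_at_right_field)
  have below: "\<theta> t \<le> \<theta>0" if t: "0 \<le> t" "ereal t < T" for t
    unfolding init[symmetric]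
  proof (rule stays_below[OF gap(2,4)])
    fix t assume t: "0 < t" "ereal t < T" "\<theta> 0 < \<theta> t" "\<theta> t < c"
    have pos: "0 < \<theta> t" using gap(3) t by auto
    have "2 * s * \<theta> t powr (2 * s) * S < 1" using c(2)[of "\<theta> t"] t init by simp
    then have "2 * S - \<theta> t powr (- 2 * s) / s < 0"
      using pos \<open>0 < s\<close> by (simp add: powr_minus divide_simps mult_ac)
    then have "\<gamma> * (2 * S - \<theta> t powr (- 2 * s) / s) < 0"
      using \<open>0 < \<gamma>\<close> by (simp add: mult_pos_neg)
    with v_le[OF t(1)] show "?v t < 0" by linarith
  qed (use that c init in auto)
  \<comment> \<open>This is the guaranteed closing speed at gap \<theta>0. The rewritten form that
    follows shows it to be positive and produces the denominator of the bound.\<close>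
  define k where "k = \<gamma> * (\<theta>0 powr (- 2 * s) / s - 2 * S)"
  have k: "k = \<gamma> * (1 - 2 * s * \<theta>0 powr (2 * s) * S) / (s * \<theta>0 powr (2 * s))"
    using \<open>0 < \<theta>0\<close> \<open>0 < s\<close> by (simp add: k_def powr_minus divide_simps)
  have "T \<le> ereal (\<theta> 0 / k)"
  proof (rule extinction_time_bound[OF gap(2,3,4)])
    show "0 < k" unfolding k using \<open>0 < \<gamma>\<close> \<open>0 < s\<close> \<open>0 < \<theta>0\<close> small by simp
    fix t assume t: "0 < t" "ereal t < T"
    have "\<theta>0 powr (- 2 * s) \<le> \<theta> t powr (- 2 * s)"
      using below[of t] gap(3)[of t] t \<open>0 < s\<close> by (intro powr_mono2') auto
    then have "\<theta>0 powr (- 2 * s) / s \<le> \<theta> t powr (- 2 * s) / s"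
      using \<open>0 < s\<close> by (intro divide_right_mono) auto
    then have "\<gamma> * (2 * S - \<theta> t powr (- 2 * s) / s) \<le> \<gamma> * (2 * S - \<theta>0 powr (- 2 * s) / s)"
      using \<open>0 < \<gamma>\<close> by (intro mult_left_mono) auto
    also have "\<dots> = - k" by (simp add: k_def algebra_simps)
    finally have "\<gamma> * (2 * S - \<theta> t powr (- 2 * s) / s) \<le> - k" .
    with v_le[OF t(1)] show "?v t \<le> - k" by linarith
  qed (use \<open>0 < T\<close> in auto)
  also have "\<theta> 0 / k = s * \<theta>0 powr (1 + 2 * s) / (\<gamma> * (1 - 2 * s * \<theta>0 powr (2 * s) * S))"
    unfolding k init using \<open>0 < \<theta>0\<close> by (simp add: powr_add)
  finally show ?thesis .
qed

section \<open>A stationary pair under constant stress\<close>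

lemma admissible_stress_const:
  assumes "0 < s" "s < 1"
  shows "admissible_stress s (\<lambda>t x. c)"
proof -
  have bdd: "bounded_stress (\<lambda>t x. d)" for d
    unfolding bounded_stress_def by (rule bounded_subset[of "{d}"]) auto
  show ?thesis
    unfolding admissible_stress_def
    \<comment> \<open>Both partial derivatives vanish, and the Hoelder exponent is the midpoint of
      \<open>s\<close> and 1.\<close>
    by (intro conjI bdd exI[of _ "\<lambda>t x. 0"] exI[of _ 1] exI[of _ "(s + 1) / 2"])
      (use assms bdd in \<open>auto simp: supnorm_const uniformly_continuous_on_const case_prod_unfold\<close>)
qed

text \<open>At distance 1 the attraction on each particle is \<gamma> / (2 * s), exactly balanced by
  the stress. Maximality is immediate, as no time exceeds \<infinity>.\<close>

lemma stationary_pair: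
  assumes "0 < s" "\<zeta> 1 = 1" "\<zeta> 2 = -1"
  defines "X \<equiv> \<lambda>i::nat. if i = 2 then 1 else 0 :: real"
  shows "has_collision_time s \<gamma> 2 \<zeta> (\<lambda>t x. 1 / (2 * s)) X (\<lambda>t. X) \<infinity>"
proof -
  have sets: "{1..2} - {1} = {2::nat}" "{1..2} - {2} = {1::nat}" by auto
  have "particle_velocity s \<gamma> 2 \<zeta> (\<lambda>t x. 1 / (2 * s)) t X i = 0" if "i = 1 \<or> i = 2" for t i
    using that by (auto simp: particle_velocity_def sets X_def assms(2,3) simp del: One_nat_def)
  moreover have "i = 1 \<or> i = 2" if "i \<in> {1..2}" for i :: nat using that by auto
  ultimately have "particle_velocity s \<gamma> 2 \<zeta> (\<lambda>t x. 1 / (2 * s)) t X i = 0" if "i \<in> {1..2}" for t i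
    using that by blast
  then show ?thesis
    unfolding has_collision_time_def particle_solution_def
    by (auto simp: X_def split: if_splits)
qed

theorem theorem1p2:
  fixes s \<gamma> :: real and W u :: "real \<Rightarrow> real" and \<zeta> :: "nat \<Rightarrow> real"
  assumes "0 < s" and "s < 1"
    and "multiwell_potential W"
    and "layer_solution s W u"
    and "\<gamma> = layer_const u"
    and "\<zeta> 1 = 1" and "\<zeta> 2 = -1"
  shows
    "(\<forall>\<sigma> x0 x Tc \<theta>0.
        admissible_stress s \<sigma> \<and> x0 1 < x0 2 \<and> \<theta>0 = x0 2 - x0 1 \<and>
        has_collision_time s \<gamma> 2 \<zeta> \<sigma> x0 x Tc \<longrightarrow>
          ((\<forall>t\<ge>0. \<forall>z. \<sigma> t z \<le> 0) \<longrightarrow>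
             Tc \<le> ereal (s * \<theta>0 powr (2 * s + 1) / ((2 * s + 1) * \<gamma>))) \<and>
          (supnorm \<sigma> = 0 \<or> \<theta>0 < (1 / (2 * s * supnorm \<sigma>)) powr (1 / (2 * s)) \<longrightarrow>
             Tc \<le> ereal (s * \<theta>0 powr (1 + 2 * s)
                           / (\<gamma> * (1 - 2 * s * \<theta>0 powr (2 * s) * supnorm \<sigma>))))) \<and>
     (\<exists>\<sigma> x0 x \<theta>0.
        admissible_stress s \<sigma> \<and> x0 1 < x0 2 \<and> \<theta>0 = x0 2 - x0 1 \<and>
        supnorm \<sigma> \<noteq> 0 \<and> \<theta>0 \<ge> (1 / (2 * s * supnorm \<sigma>)) powr (1 / (2 * s)) \<and>
        has_collision_time s \<gamma> 2 \<zeta> \<sigma> x0 x \<infinity>)"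
proof (intro conjI allI impI; (elim conjE)?)
  have "0 < \<gamma>" using layer_const_pos assms by simp
  fix \<sigma> x0 x Tc \<theta>0
  assume "admissible_stress s \<sigma>" "x0 1 < x0 2" and \<theta>0: "\<theta>0 = x0 2 - x0 1"
    and "has_collision_time s \<gamma> 2 \<zeta> \<sigma> x0 x Tc"
  then have sol: "particle_solution s \<gamma> 2 \<zeta> \<sigma> x0 Tc x" "bounded_stress \<sigma>"
    by (auto simp: has_collision_time_def admissible_stress_def)
  note sol = sol(1) assms(6,7) \<open>x0 1 < x0 2\<close> assms(1) \<open>0 < \<gamma>\<close> sol(2)
  {
    assume "\<forall>t\<ge>0. \<forall>z. \<sigma> t z \<le> 0"
    then show "Tc \<le> ereal (s * \<theta>0 powr (2 * s + 1) / ((2 * s + 1) * \<gamma>))"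
      unfolding \<theta>0 by (intro collision_time_nonpos_stress[OF sol(1-6)]) auto
  next
    let ?S = "supnorm \<sigma>"
    assume small: "?S = 0 \<or> \<theta>0 < (1 / (2 * s * ?S)) powr (1 / (2 * s))"
    have S: "\<bar>\<sigma> t z\<bar> \<le> ?S" if "0 \<le> t" for t z
      using le_supnorm[OF sol(7) that] .
    have "2 * s * \<theta>0 powr (2 * s) * ?S < 1"
    \<comment> \<open>With \<open>?S = 0\<close> the threshold is 0 under division by zero, which no
      positive gap meets, hence the separate case. The required inequality then reads
      \<open>0 < 1\<close>.\<close>
    proof (cases "?S = 0")
      case False
      then have "0 < ?S" using S[of 0 0] by simp
      have "\<theta>0 powr (2 * s) < ((1 / (2 * s * ?S)) powr (1 / (2 * s))) powr (2 * s)"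
        using small False \<open>x0 1 < x0 2\<close> assms(1) \<theta>0 by (intro powr_less_mono2) auto
      also have "\<dots> = 1 / (2 * s * ?S)"
        using assms(1) \<open>0 < ?S\<close> by (simp add: powr_powr)
      finally show ?thesis using assms(1) \<open>0 < ?S\<close> by (simp add: field_simps)
    qed simp
    then show "Tc \<le> ereal (s * \<theta>0 powr (1 + 2 * s) / (\<gamma> * (1 - 2 * s * \<theta>0 powr (2 * s) * ?S)))"
      by (intro collision_time_small_gap[OF sol(1-6) _ \<theta>0] S)
  }
next
  \<comment> \<open>The norm of the constant stress is \<open>1 / (2 * s)\<close>, so the threshold
    equals 1 and the gap 1 attains it with equality.\<close>
  show "\<exists>\<sigma> x0 x \<theta>0.
        admissible_stress s \<sigma> \<and> x0 1 < x0 2 \<and> \<theta>0 = x0 2 - x0 1 \<and>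
        supnorm \<sigma> \<noteq> 0 \<and> \<theta>0 \<ge> (1 / (2 * s * supnorm \<sigma>)) powr (1 / (2 * s)) \<and>
        has_collision_time s \<gamma> 2 \<zeta> \<sigma> x0 x \<infinity>"
    using admissible_stress_const[OF assms(1,2), of "1 / (2 * s)"] stationary_pair[OF assms(1,6,7), of \<gamma>]
      assms(1)
    by (intro exI[of _ "\<lambda>t x. 1 / (2 * s)"] exI[of _ "\<lambda>i. if i = 2 then 1 else 0"]
        exI[of _ "\<lambda>t i. if i = 2 then 1 else 0"] exI[of _ 1]) (simp add: supnorm_const)
qed

end
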